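(* Let $(X,M,\ast)$ be an $M$-complete fuzzy metric space in the sense of Kramosil and Michálek such that $(X,M)$ satisfies the property $\mathcal{NC}$ and the t-norm $\ast$ is continuous at the $1$-boundary. Let $\psi:[0,1]\to[0,1]$ be a continuous and nondecreasing function such that $\psi(t)>t$ for all $t\in(0,1)$, and let $T:X\to X$ be a mapping such that, for all $x,y\in X$ and all $t>0$, $$M(x,y,t)>0\quad\Rightarrow\quad M(Tx,Ty,t)\ge\psi(M(x,y,t)).$$ If there exists $x\in X$ such that $M(x,Tx,t)>0$ for all $t>0$, then $T$ has a fixed point.
   Context: Notation: $\mathbb{I}=[0,1]$, $\mathbb{N}=\{1,2,\ldots\}$. A t-norm is a function $\ast:\mathbb{I}\times\mathbb{I}\to\mathbb{I}$ that is associative, commutative, nondecreasing in each argument and has $1$ as unity; it is continuous at the $1$-boundary if it is continuous at each point $(1,s)$, $s\in\mathbb{I}$. A fuzzy metric space in the sense of Kramosil and Michálek (KM-FMS) is a triple $(X,M,\ast)$ with $X$ non-empty, $\ast$ a t-norm and $M:X\times X\times[0,\infty)\to\mathbb{I}$ such that for all $x,y,z\in X$, $t,s\ge0$: (1) $M(x,y,0)=0$; (2) $M(x,y,t)=1$ for all $t>0$ iff $x=y$; (3) $M(x,y,t)=M(y,x,t)$; (4) $M(x,z,t+s)\ge M(x,y,t)\ast M(y,z,s)$; (5) $M(x,y,\cdot)$ is left-continuous on $[0,\infty)$. A sequence $\{x_n\}$ is $M$-Cauchy if for all $\varepsilon\in(0,1)$, $t>0$ there is $n_0$ with $M(x_n,x_m,t)>1-\varepsilon$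 for all $n,m\ge n_0$; it $M$-converges to $x$ if $\lim_nM(x_n,x,t)=1$ for all $t>0$. $X$ is $M$-complete if each $M$-Cauchy sequence in $X$ is $M$-convergent to a point of $X$. $(X,M)$ satisfies the property $\mathcal{NC}$ if for each sequence $\{x_n\}\subseteq X$ which is not $M$-Cauchy and verifies $\lim_{n\to\infty}M(x_n,x_{n+1},t)=1$ for all $t>0$, there are $\varepsilon_0\in(0,1)$, $t_0>0$ and two subsequences $\{x_{n(k)}\}_{k\in\mathbb{N}}$, $\{x_{m(k)}\}_{k\in\mathbb{N}}$ of $\{x_n\}$ such that, for all $k\in\mathbb{N}$, $k<n(k)<m(k)<n(k+1)$ and $M(x_{n(k)},x_{m(k)-1},t_0)>1-\varepsilon_0\ge M(x_{n(k)},x_{m(k)},t_0)$, and also $\lim_{k\to\infty}M(x_{n(k)},x_{m(k)},t_0)=\lim_{k\to\infty}M(x_{n(k)-1},x_{m(k)-1},t_0)=1-\varepsilon_0$. *)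

theory Defs
  imports "HOL-Analysis.Analysis"
begin

(* Functions on the unit interval or on [0,\<infinity>) are total functions on the reals;
   only their values on the intended domain are constrained. *)

locale t_norm =
  fixes tn :: "real \<Rightarrow> real \<Rightarrow> real"
  assumes closed: "\<lbrakk>a \<in> {0..1}; b \<in> {0..1}\<rbrakk> \<Longrightarrow> tn a b \<in> {0..1}"
    and assoc: "\<lbrakk>a \<in> {0..1}; b \<in> {0..1}; c \<in> {0..1}\<rbrakk> \<Longrightarrow> tn (tn a b) c = tn a (tn b c)"
    and commute: "\<lbrakk>a \<in> {0..1}; b \<in> {0..1}\<rbrakk> \<Longrightarrow> tn a b = tn b a"
    and mono_left: "\<lbrakk>a \<in> {0..1}; b \<in> {0..1}; c \<in> {0..1}; a \<le> b\<rbrakk> \<Longrightarrow> tn a c \<le> tn b c"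
    and mono_right: "\<lbrakk>a \<in> {0..1}; b \<in> {0..1}; c \<in> {0..1}; a \<le> b\<rbrakk> \<Longrightarrow> tn c a \<le> tn c b"
    and unit_left: "a \<in> {0..1} \<Longrightarrow> tn 1 a = a"
    and unit_right: "a \<in> {0..1} \<Longrightarrow> tn a 1 = a"

definition continuous_at_1_boundary :: "(real \<Rightarrow> real \<Rightarrow> real) \<Rightarrow> bool" where
  "continuous_at_1_boundary tn \<longleftrightarrow>
     (\<forall>s\<in>{0..1}. continuous (at (1, s) within {0..1} \<times> {0..1}) (\<lambda>p. tn (fst p) (snd p)))"

(* At t = 0 the filter in left_cont is trivial: left-continuity holds there vacuously. *)

locale KM_fuzzy_metric_space = t_norm tn
  for X :: "'a set" and M :: "'a \<Rightarrow> 'a \<Rightarrow> real \<Rightarrow> real" and tn :: "real \<Rightarrow> real \<Rightarrow> real" +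
  assumes nonempty: "X \<noteq> {}"
    and range: "\<lbrakk>x \<in> X; y \<in> X; 0 \<le> t\<rbrakk> \<Longrightarrow> M x y t \<in> {0..1}"
    and zero: "\<lbrakk>x \<in> X; y \<in> X\<rbrakk> \<Longrightarrow> M x y 0 = 0"
    and eq_iff: "\<lbrakk>x \<in> X; y \<in> X\<rbrakk> \<Longrightarrow> (\<forall>t>0. M x y t = 1) \<longleftrightarrow> x = y"
    and sym: "\<lbrakk>x \<in> X; y \<in> X; 0 \<le> t\<rbrakk> \<Longrightarrow> M x y t = M y x t"
    and triangle: "\<lbrakk>x \<in> X; y \<in> X; z \<in> X; 0 \<le> t; 0 \<le> s\<rbrakk>
                    \<Longrightarrow> M x z (t + s) \<ge> tn (M x y t) (M y z s)"
    and left_cont: "\<lbrakk>x \<in> X; y \<in> X; 0 \<le> t\<rbrakk> \<Longrightarrow> continuous (at t within {0..t}) (M x y)"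

definition M_Cauchy :: "('a \<Rightarrow> 'a \<Rightarrow> real \<Rightarrow> real) \<Rightarrow> (nat \<Rightarrow> 'a) \<Rightarrow> bool" where
  "M_Cauchy M u \<longleftrightarrow>
     (\<forall>\<epsilon>\<in>{0<..<1}. \<forall>t>0. \<exists>n0. \<forall>n\<ge>n0. \<forall>m\<ge>n0. M (u n) (u m) t > 1 - \<epsilon>)"

definition M_converges :: "('a \<Rightarrow> 'a \<Rightarrow> real \<Rightarrow> real) \<Rightarrow> (nat \<Rightarrow> 'a) \<Rightarrow> 'a \<Rightarrow> bool" where
  "M_converges M u x \<longleftrightarrow> (\<forall>t>0. (\<lambda>n. M (u n) x t) \<longlonglongrightarrow> 1)"

definition M_complete :: "'a set \<Rightarrow> ('a \<Rightarrow> 'a \<Rightarrow> real \<Rightarrow> real) \<Rightarrow> bool" where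
  "M_complete X M \<longleftrightarrow>
     (\<forall>u. range u \<subseteq> X \<longrightarrow> M_Cauchy M u \<longrightarrow> (\<exists>x\<in>X. M_converges M u x))"

(* Sequences are indexed from 0 instead of 1. Shifting the indices k, n k and m k by one
   preserves k < n k < m k < n (k + 1) and all the other conditions. As 0 \<le> k < n k < m k,
   the natural-number differences n k - 1 and m k - 1 are never truncated. *)

definition property_NC :: "'a set \<Rightarrow> ('a \<Rightarrow> 'a \<Rightarrow> real \<Rightarrow> real) \<Rightarrow> bool" where
  "property_NC X M \<longleftrightarrow>
     (\<forall>u. range u \<subseteq> X \<longrightarrow> \<not> M_Cauchy M u \<longrightarrow>
        (\<forall>t>0. (\<lambda>n. M (u n) (u (Suc n)) t) \<longlonglongrightarrow> 1) \<longrightarrow>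
        (\<exists>\<epsilon>0\<in>{0<..<1}. \<exists>t0>0. \<exists>n m :: nat \<Rightarrow> nat.
           (\<forall>k. k < n k \<and> n k < m k \<and> m k < n (k + 1) \<and>
                M (u (n k)) (u (m k - 1)) t0 > 1 - \<epsilon>0 \<and>
                1 - \<epsilon>0 \<ge> M (u (n k)) (u (m k)) t0) \<and>
           (\<lambda>k. M (u (n k)) (u (m k)) t0) \<longlonglongrightarrow> 1 - \<epsilon>0 \<and>
           (\<lambda>k. M (u (n k - 1)) (u (m k - 1)) t0) \<longlonglongrightarrow> 1 - \<epsilon>0))"

end

(* For a point x with M x (T x) t > 0 for all t > 0, the values M (u n) (u (n+1)) t along the
   Picard orbit u of x increase to a limit L in (0,1] with \<psi> L \<le> L, which can only be L = 1.
   If u were not M-Cauchy, passing to the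
   limit in the contraction along the two subsequences given by property NC would yield
   1 - \<epsilon>0 \<ge> \<psi> (1 - \<epsilon>0) > 1 - \<epsilon>0. So u converges, and its limit is fixed by T. *)

theory Submission
  imports Defs
begin

text \<open>Only the endpoint 1 needs an argument: monotonicity gives
  \<open>\<psi> 1 \<ge> \<psi> r > r\<close> for every r in (0,1), and r may be taken arbitrarily
  close to 1.\<close>

lemma comparison_function_ge:
  fixes \<psi> :: "real \<Rightarrow> real"
  assumes mono: "mono_on {0..1} \<psi>"
    and gt: "\<And>t. t \<in> {0<..<1} \<Longrightarrow> \<psi> t > t"
    and t: "t \<in> {0<..1}"
  shows "\<psi> t \<ge> t"
proof (cases "t = 1")
  case True
  have "\<psi> 1 \<ge> s" if "s < 1" for s
  proof -
    \<comment> \<open>The number s may be nonpositive; the maximum with 1/2 moves it into (0,1),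
      where \<open>gt\<close> applies.\<close>
    define r where "r = max s (1/2)"
    have r: "r \<in> {0<..<1}" using that by (auto simp: r_def)
    have "r < \<psi> r" using gt r by blast
    also have "\<psi> r \<le> \<psi> 1" using r by (intro mono_onD[OF mono]) auto
    finally show ?thesis by (simp add: r_def)
  qed
  then show ?thesis using True dense_le by blast
next
  case False
  then show ?thesis using gt[of t] t by auto
qed

text \<open>Meant for \<open>a n = M (u n) (u (Suc n)) t\<close> with t fixed. Like the contraction
  condition, \<open>step\<close> speaks only of positive values, so positivity has to be propagated
  from \<open>a 0\<close> together with monotonicity.\<close>

lemma comparison_iteration_tendsto_1:
  fixes a :: "nat \<Rightarrow> real" and \<psi> :: "real \<Rightarrow> real"
  assumes cont: "continuous_on {0..1} \<psi>"
    and mono: "mono_on {0..1} \<psi>"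
    and gt: "\<And>t. t \<in> {0<..<1} \<Longrightarrow> \<psi> t > t"
    and a: "\<And>n. a n \<in> {0..1}" "a 0 > 0"
    and step: "\<And>n. a n > 0 \<Longrightarrow> a (Suc n) \<ge> \<psi> (a n)"
  shows "a \<longlonglongrightarrow> 1"
proof -
  note ge = comparison_function_ge[OF mono gt]
  have incr: "a (Suc n) \<ge> a n" if "a n > 0" for n
    using step[OF that] ge[of "a n"] a(1)[of n] that by auto
  have pos: "a n > 0" for n
    by (induction n) (use a(2) incr in \<open>auto intro: less_le_trans\<close>)
  have "incseq a" using incr pos by (simp add: incseq_SucI)
  then obtain L where L: "a \<longlonglongrightarrow> L" "\<And>n. a n \<le> L"
    using incseq_convergent[of a 1] a(1) by auto
  have "L \<le> 1" using L(1) a(1) by (intro LIMSEQ_le_const2[OF L(1)]) auto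
  \<comment> \<open>The value 0 must be excluded separately: \<open>\<psi> 0 = 0\<close> is
    possible, so \<open>\<psi> L \<le> L\<close> alone would not rule it out.\<close>
  moreover have "0 < L" using L(2)[of 0] a(2) by simp
  ultimately have L01: "L \<in> {0<..1}" by simp
  have "(\<lambda>n. \<psi> (a n)) \<longlonglongrightarrow> \<psi> L"
    by (rule continuous_on_tendsto_compose[OF cont L(1)]) (use L01 a(1) in auto)
  then have "\<psi> L \<le> L"
    using LIMSEQ_le[OF _ LIMSEQ_Suc[OF L(1)]] step pos by blast
  then have "L = 1" using gt[of L] L01 by fastforce
  with L(1) show ?thesis by simp
qed

text \<open>Split t into two halves and pass to the limit in the triangle inequality through
  \<open>u n\<close>: by continuity of \<open>tn\<close> at (1,1) the lower bound for
  \<open>M x y t\<close> tends to \<open>tn 1 1 = 1\<close>.\<close>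

lemma (in KM_fuzzy_metric_space) M_converges_unique:
  assumes cont: "continuous_at_1_boundary tn"
    and u: "range u \<subseteq> X" and xy: "x \<in> X" "y \<in> X"
    and convx: "M_converges M u x" and convy: "M_converges M u y"
  shows "x = y"
proof -
  have "M x y t = 1" if t: "t > 0" for t
  proof -
    have uX: "u n \<in> X" for n using u by auto
    have half: "0 < t / 2" using t by simp
    let ?p = "\<lambda>n. (M x (u n) (t/2), M (u n) y (t/2))"
    have "(\<lambda>n. M (u n) x (t/2)) \<longlonglongrightarrow> 1"
      and "(\<lambda>n. M (u n) y (t/2)) \<longlonglongrightarrow> 1"
      using convx convy half by (auto simp: M_converges_def)
    moreover have "M (u n) x (t/2) = M x (u n) (t/2)" for n
      using sym uX xy half by simp
    ultimately have lim: "?p \<longlonglongrightarrow> (1, 1)" by (simp add: tendsto_Pair)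
    \<comment> \<open>Continuity of \<open>tn\<close> is available only within the unit square, so
      the pairs must stay inside it.\<close>
    have mem: "?p n \<in> {0..1} \<times> {0..1}" for n
      using range[of x "u n" "t/2"] range[of "u n" y "t/2"] uX xy half by simp
    have "continuous (at (1, 1) within {0..1} \<times> {0..1}) (\<lambda>p. tn (fst p) (snd p))"
      using cont by (simp add: continuous_at_1_boundary_def)
    from continuous_within_tendsto_compose[OF this _ lim]
    have "(\<lambda>n. tn (M x (u n) (t/2)) (M (u n) y (t/2))) \<longlonglongrightarrow> tn 1 1"
      using mem by simp
    moreover have "tn (M x (u n) (t/2)) (M (u n) y (t/2)) \<le> M x y t" for n
      using triangle[of x "u n" y "t/2" "t/2"] uX xy half by simp
    ultimately have "tn 1 1 \<le> M x y t"
      by (intro LIMSEQ_le_const2) auto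
    then show ?thesis using unit_left[of 1] range[of x y t] xy t by simp
  qed
  then show ?thesis using eq_iff xy by blast
qed

theorem mainTheorem7:
  fixes X :: "'a set"
    and M :: "'a \<Rightarrow> 'a \<Rightarrow> real \<Rightarrow> real"
    and tn :: "real \<Rightarrow> real \<Rightarrow> real"
    and \<psi> :: "real \<Rightarrow> real"
    and T :: "'a \<Rightarrow> 'a"
  assumes "KM_fuzzy_metric_space X M tn"
    and "M_complete X M"
    and "property_NC X M"
    and "continuous_at_1_boundary tn"
    and "\<psi> \<in> {0..1} \<rightarrow> {0..1}"
    and "continuous_on {0..1} \<psi>"
    and "mono_on {0..1} \<psi>"
    and "\<And>t. t \<in> {0<..<1} \<Longrightarrow> \<psi> t > t"
    and "T \<in> X \<rightarrow> X"
    and "\<And>x y t. \<lbrakk>x \<in> X; y \<in> X; t > 0; M x y t > 0\<rbrakk> \<Longrightarrow> M (T x) (T y) t \<ge> \<psi> (M x y t)"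
    and "\<exists>x\<in>X. \<forall>t>0. M x (T x) t > 0"
  shows "\<exists>x\<in>X. T x = x"
proof -
  interpret KM_fuzzy_metric_space X M tn by fact
  note cont = assms(6) and mono = assms(7) and gt = assms(8) and contr = assms(10)
  have TX: "T x \<in> X" if "x \<in> X" for x using assms(9) that by auto
  note ge = comparison_function_ge[OF mono gt]
  obtain x0 where x0: "x0 \<in> X" "\<And>t. t > 0 \<Longrightarrow> M x0 (T x0) t > 0" using assms(11) by blast
  define u where "u n = (T ^^ n) x0" for n
  have u_Suc: "u (Suc n) = T (u n)" for n by (simp add: u_def)
  have uX: "u n \<in> X" for n by (induction n) (simp_all add: u_Suc TX, simp add: u_def x0)
  have range_u: "range u \<subseteq> X" using uX by blast
  have asym_reg: "(\<lambda>n. M (u n) (u (Suc n)) t) \<longlonglongrightarrow> 1" if t: "t > 0" for t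
  proof (rule comparison_iteration_tendsto_1[OF cont mono gt])
    show "M (u n) (u (Suc n)) t \<in> {0..1}" for n using range uX t by simp
    show "M (u 0) (u (Suc 0)) t > 0" using x0(2)[OF t] by (simp add: u_def)
    show "M (u (Suc n)) (u (Suc (Suc n))) t \<ge> \<psi> (M (u n) (u (Suc n)) t)"
      if "M (u n) (u (Suc n)) t > 0" for n
      using contr[OF uX uX t that] by (simp add: u_Suc)
  qed
  have "M_Cauchy M u"
  proof (rule ccontr)
    assume "\<not> M_Cauchy M u"
    moreover have "\<forall>t>0. (\<lambda>n. M (u n) (u (Suc n)) t) \<longlonglongrightarrow> 1" using asym_reg by blast
    ultimately obtain e t n m where e: "e \<in> {0<..<1}" and t: "t > 0"
      and nm: "\<forall>k. k < n k \<and> n k < m k \<and> m k < n (k + 1) \<and>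
                  M (u (n k)) (u (m k - 1)) t > 1 - e \<and> 1 - e \<ge> M (u (n k)) (u (m k)) t"
      and lim: "(\<lambda>k. M (u (n k)) (u (m k)) t) \<longlonglongrightarrow> 1 - e"
      and lim': "(\<lambda>k. M (u (n k - 1)) (u (m k - 1)) t) \<longlonglongrightarrow> 1 - e"
      using spec[OF assms(3)[unfolded property_NC_def], of u] range_u
      by (elim impE bexE exE conjE) auto
    \<comment> \<open>\<open>T\<close> maps this pair of predecessors to \<open>u (n k)\<close> and
      \<open>u (m k)\<close>, and both pairs have the same limit \<open>1 - e\<close>.\<close>
    let ?b = "\<lambda>k. M (u (n k - 1)) (u (m k - 1)) t"
    have "(\<lambda>k. \<psi> (?b k)) \<longlonglongrightarrow> \<psi> (1 - e)"
      by (rule continuous_on_tendsto_compose[OF cont lim']) (use e range uX t in auto)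
    \<comment> \<open>The contraction needs a positive value; since \<open>1 - e > 0\<close>, this
      holds for all large k.\<close>
    moreover have "\<forall>\<^sub>F k in sequentially. ?b k > 0"
      using order_tendstoD(1)[OF lim', of 0] e by simp
    then have "\<forall>\<^sub>F k in sequentially. \<psi> (?b k) \<le> M (u (n k)) (u (m k)) t"
    proof (rule eventually_mono)
      fix k assume "?b k > 0"
      then have "\<psi> (?b k) \<le> M (T (u (n k - 1))) (T (u (m k - 1))) t"
        using contr uX t by blast
      \<comment> \<open>Both indices exceed k, hence are at least 1, and the subtraction is not
        truncated.\<close>
      moreover have "T (u (n k - 1)) = u (n k)" "T (u (m k - 1)) = u (m k)"
        using spec[OF nm, of k] by (simp_all flip: u_Suc)
      ultimately show "\<psi> (?b k) \<le> M (u (n k)) (u (m k)) t" by simp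
    qed
    ultimately have "\<psi> (1 - e) \<le> 1 - e"
      by (intro tendsto_le[OF _ lim]) auto
    then show False using gt[of "1 - e"] e by simp
  qed
  then obtain x where x: "x \<in> X" "M_converges M u x"
    using assms(2) range_u unfolding M_complete_def by blast
  have to_x: "(\<lambda>n. M (u n) x t) \<longlonglongrightarrow> 1" if "t > 0" for t
    using x(2) that by (simp add: M_converges_def)
  \<comment> \<open>The shifted orbit is also the image of the orbit under \<open>T\<close>; it is
    shown to converge to both \<open>x\<close> and \<open>T x\<close>, which uniqueness of limits
    then identifies.\<close>
  have "M_converges M (\<lambda>n. u (Suc n)) x"
    using LIMSEQ_Suc[OF to_x] by (simp add: M_converges_def)
  moreover have "M_converges M (\<lambda>n. u (Suc n)) (T x)"
    unfolding M_converges_def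
  proof (intro allI impI)
    fix t :: real assume t: "t > 0"
    show "(\<lambda>n. M (u (Suc n)) (T x) t) \<longlonglongrightarrow> 1"
    \<comment> \<open>The lower bound \<open>M (u n) x t\<close> comes from the contraction followed
      by \<open>\<psi> s \<ge> s\<close> for s in (0,1]. It is claimed only for large n, where
      convergence to 1 makes \<open>M (u n) x t\<close> positive.\<close>
    proof (rule tendsto_sandwich[OF _ _ to_x[OF t] tendsto_const])
      show "\<forall>\<^sub>F n in sequentially. M (u n) x t \<le> M (u (Suc n)) (T x) t"
        using order_tendstoD(1)[OF to_x[OF t], of 0, simplified]
      proof (rule eventually_mono)
        fix n assume pos: "M (u n) x t > 0"
        have "M (u n) x t \<le> \<psi> (M (u n) x t)"
          using ge[of "M (u n) x t"] pos range[of "u n" x t] uX x(1) t by simp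
        also have "\<dots> \<le> M (u (Suc n)) (T x) t"
          using contr[OF uX x(1) t pos] by (simp add: u_Suc)
        finally show "M (u n) x t \<le> M (u (Suc n)) (T x) t" .
      qed
      show "\<forall>\<^sub>F n in sequentially. M (u (Suc n)) (T x) t \<le> 1"
        using range uX TX x(1) t by simp
    qed
  qed
  ultimately have "x = T x"
    using uX TX x(1) by (intro M_converges_unique[OF assms(4)]) auto
  with x(1) show ?thesis by metis
qed

end
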